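(* Let $W$ be the set of states of a world containing an agent with action set $A$, and let $\sim$ be the equivalence relation on $A$ given by $a\sim a'$ iff $a*w=a'*w$ for all $w\in W$. If $*:(A/\sim)\times W\to W$ is a group action, then for each $a\in A/\sim$ there exists $a'\in A/\sim$ such that $(a'\circ a)*w=w$ and $(a\circ a')*w=w$ for all $w\in W$.
   Context: A world is a directed multigraph $(W,\hat D,s,t)$ with vertex set $W$ (world states), arrow set $\hat D$ and source and target maps $s,t:\hat D\to W$; for each $w\in W$ there is a distinguished trivial arrow $1_w\in\hat D$ with $s(1_w)=t(1_w)=w$. $D$ is the set of all paths $\hat d_n\circ\cdots\circ\hat d_1$ ($n\ge 1$, $t(\hat d_i)=s(\hat d_{i+1})$), with $s,t$ extended to paths by taking the source of the first arrow and the target of the last. Agent and actions. There is a set $\hat A$ (minimum actions); $A$ is the set of all nonempty finite sequences of elements of $\hat A$, and $\circ$ on $A$ is concatenation, with $a'\circ a$ meaning "first $a$, then $a'$". There is a subset $\hat D_A\subset D$ (minimum action transitions) with $1_w\in\hat D_A$ for all $w\in W$, and a labelling map $\hat l:\hat D_A\to\hat A$ such that: (i) if $d\ne d'$ in $\hat D_A$ have $s(d)=s(d')$ then $\hat l(d)\neq\hat l(d')$; (ii) there is an element $1\in\hat A$ (the identity action) with $\hat l(1_w)=1$ for all $w\in W$. $D_A$ is the set of all nonempty paths in the multigraph with vertices $W$ and arrows $\hat D_A$; the labelling extends to $l:D_A\to A$ by $l(d_n\circ\cdots\circ d_1)=\hat l(d_n)\cdots\hat l(d_1)$. Standing assumption: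 every world state transition is due to the agent, i.e. $D=D_A$ (every path in $D$ is a composite of minimum action transitions). Effect of actions. For $a\in A$, $w\in W$: if there is $d\in D_A$ with $s(d)=w$ and $l(d)=a$, then $a*w=t(d)$ (unambiguous by (i)); otherwise $a*w$ is undefined. The equality $a*w=a'*w$ means that either both sides are undefined, or both are defined and equal. $[a]_\sim$ denotes the class of $a$; composition on $A/\sim$ is the (well-defined) operation $[a']_\sim\circ[a]_\sim=[a'\circ a]_\sim$, and the effect of a class on a state is $[a]_\sim*w=a*w$ (undefined if $a*w$ is undefined), so a priori $*$ is only a partial operation. "$*$ is a group action" means: $(A/\sim,\circ)$ is a group, $*$ is everywhere defined on $(A/\sim)\times W$, the group identity fixes every $w\in W$, and $g'*(g*w)=(g'\circ g)*w$ for all $g,g'\in A/\sim$, $w\in W$. *)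

theory Defs
  imports "Graph_Theory.Arc_Walk" "HOL-Algebra.Group"
begin

text \<open>
  Paths and action sequences are lists in temporal order: the path \<open>d\<^sub>n \<circ> \<dots> \<circ> d\<^sub>1\<close> is
  the list \<open>[d\<^sub>1, \<dots>, d\<^sub>n]\<close>. Composition \<open>a' \<circ> a\<close> (first \<open>a\<close>, then \<open>a'\<close>) is therefore
  the list \<open>a @ a'\<close>.
\<close>

definition paths :: "('w, 'd) pre_digraph \<Rightarrow> 'd list set" where
  "paths G = {p. p \<noteq> [] \<and> (\<exists>u v. pre_digraph.awalk G u p v)}"

definition path_source :: "('w, 'd) pre_digraph \<Rightarrow> 'd list \<Rightarrow> 'w" where
  "path_source G p = tail G (hd p)"

definition path_target :: "('w, 'd) pre_digraph \<Rightarrow> 'd list \<Rightarrow> 'w" where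
  "path_target G p = head G (last p)"

locale world = wf_digraph G for G :: "('w, 'd) pre_digraph" +
  fixes triv :: "'w \<Rightarrow> 'd"
  assumes triv_in_arcs: "w \<in> verts G \<Longrightarrow> triv w \<in> arcs G"
    and tail_triv: "w \<in> verts G \<Longrightarrow> tail G (triv w) = w"
    and head_triv: "w \<in> verts G \<Longrightarrow> head G (triv w) = w"

record ('w, 'd, 'a) agent_world =
  world_graph :: "('w, 'd) pre_digraph"
  trivial_arrow :: "'w \<Rightarrow> 'd"
  min_actions :: "'a set"
  min_transitions :: "'d list set"
  min_label :: "'d list \<Rightarrow> 'a"
  id_action :: "'a"

abbreviation states :: "('w, 'd, 'a) agent_world \<Rightarrow> 'w set" where
  "states M \<equiv> verts (world_graph M)"

text \<open>
  An arrow of the following multigraph is itself a path of the world graph, so an element of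
  \<open>D\<^sub>A\<close> is a list of paths, which \<^const>\<open>concat\<close> turns into the composite path of the world.
\<close>

definition transition_graph :: "('w, 'd, 'a) agent_world \<Rightarrow> ('w, 'd list) pre_digraph" where
  "transition_graph M =
     \<lparr>verts = states M, arcs = min_transitions M,
      tail = path_source (world_graph M), head = path_target (world_graph M)\<rparr>"

definition action_paths :: "('w, 'd, 'a) agent_world \<Rightarrow> 'd list list set" where
  "action_paths M = paths (transition_graph M)"

definition path_label :: "('w, 'd, 'a) agent_world \<Rightarrow> 'd list list \<Rightarrow> 'a list" where
  "path_label M = map (min_label M)"

definition actions :: "('w, 'd, 'a) agent_world \<Rightarrow> 'a list set" where
  "actions M = {a. a \<noteq> [] \<and> set a \<subseteq> min_actions M}"

definition action_comp :: "'a list \<Rightarrow> 'a list \<Rightarrow> 'a list" where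
  "action_comp a' a = a @ a'"

locale agent_world =
  fixes M :: "('w, 'd, 'a) agent_world"
  assumes world: "world (world_graph M) (trivial_arrow M)"
    and min_transitions_paths: "min_transitions M \<subseteq> paths (world_graph M)"
    and triv_min_transition: "w \<in> states M \<Longrightarrow> [trivial_arrow M w] \<in> min_transitions M"
    and min_label_closed: "d \<in> min_transitions M \<Longrightarrow> min_label M d \<in> min_actions M"
    and min_label_distinct:
      "\<lbrakk>d \<in> min_transitions M; d' \<in> min_transitions M; d \<noteq> d';
        path_source (world_graph M) d = path_source (world_graph M) d'\<rbrakk>
       \<Longrightarrow> min_label M d \<noteq> min_label M d'"
    and id_action_closed: "id_action M \<in> min_actions M"
    and min_label_triv: "w \<in> states M \<Longrightarrow> min_label M [trivial_arrow M w] = id_action M"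
    and all_transitions_by_agent: "paths (world_graph M) = concat ` action_paths M"

text \<open>The effect \<open>a * w\<close>, with \<^const>\<open>None\<close> for ``undefined''.\<close>

definition effect :: "('w, 'd, 'a) agent_world \<Rightarrow> 'a list \<Rightarrow> 'w \<Rightarrow> 'w option" where
  "effect M a w =
     (let P = (\<lambda>d. d \<in> action_paths M \<and> path_source (transition_graph M) d = w
                   \<and> path_label M d = a)
      in if \<exists>d. P d then Some (path_target (transition_graph M) (THE d. P d)) else None)"

definition act_equiv :: "('w, 'd, 'a) agent_world \<Rightarrow> ('a list \<times> 'a list) set" where
  "act_equiv M = {(a, a'). a \<in> actions M \<and> a' \<in> actions M \<and>
                           (\<forall>w\<in>states M. effect M a w = effect M a' w)}"

definition class_comp ::
    "('w, 'd, 'a) agent_world \<Rightarrow> 'a list set \<Rightarrow> 'a list set \<Rightarrow> 'a list set" where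
  "class_comp M X' X = (\<Union>a'\<in>X'. \<Union>a\<in>X. act_equiv M `` {action_comp a' a})"

definition class_effect ::
    "('w, 'd, 'a) agent_world \<Rightarrow> 'a list set \<Rightarrow> 'w \<Rightarrow> 'w option" where
  "class_effect M X w = the_elem ((\<lambda>a. effect M a w) ` X)"

text \<open>
  The unit field is the class of the identity action; by lemma \<open>monoid_act_monoid\<close>
  below it is always a two-sided identity, so requiring \<^const>\<open>group\<close> of this structure adds
  only the existence of inverses.
\<close>

definition act_monoid :: "('w, 'd, 'a) agent_world \<Rightarrow> 'a list set monoid" where
  "act_monoid M =
     \<lparr>carrier = actions M // act_equiv M, mult = class_comp M,
      one = act_equiv M `` {[id_action M]}\<rparr>"

definition effect_is_group_action :: "('w, 'd, 'a) agent_world \<Rightarrow> bool" where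
  "effect_is_group_action M \<longleftrightarrow>
     group (act_monoid M) \<and>
     (\<forall>g\<in>carrier (act_monoid M). \<forall>w\<in>states M. class_effect M g w \<noteq> None) \<and>
     (\<forall>w\<in>states M. class_effect M \<one>\<^bsub>act_monoid M\<^esub> w = Some w) \<and>
     (\<forall>g\<in>carrier (act_monoid M). \<forall>g'\<in>carrier (act_monoid M). \<forall>w\<in>states M.
        Option.bind (class_effect M g w) (class_effect M g') =
        class_effect M (g' \<otimes>\<^bsub>act_monoid M\<^esub> g) w)"


subsection \<open>Well-definedness\<close>

lemma equiv_act_equiv: "equiv (actions M) (act_equiv M)"
  by (rule equivI) (auto simp: act_equiv_def refl_on_def sym_def trans_def)

lemma class_effect_class:
  assumes "a \<in> actions M" "w \<in> states M"
  shows "class_effect M (act_equiv M `` {a}) w = effect M a w"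
proof -
  have "(\<lambda>a'. effect M a' w) ` (act_equiv M `` {a}) = {effect M a w}"
    using assms by (auto simp: act_equiv_def image_iff)
  then show ?thesis by (simp add: class_effect_def)
qed

context agent_world
begin

abbreviation (input) "T \<equiv> transition_graph M"

lemma T_simps [simp]:
  "verts T = states M" "arcs T = min_transitions M"
  "tail T = path_source (world_graph M)" "head T = path_target (world_graph M)"
  by (simp_all add: transition_graph_def)

lemma path_ends_in_states:
  assumes "d \<in> paths (world_graph M)"
  shows "path_source (world_graph M) d \<in> states M" "path_target (world_graph M) d \<in> states M"
proof -
  interpret world "world_graph M" "trivial_arrow M" by (rule world)
  have "d \<noteq> []" "set d \<subseteq> arcs (world_graph M)"
    using assms by (auto simp: paths_def awalk_def)
  then have "hd d \<in> arcs (world_graph M)" "last d \<in> arcs (world_graph M)" by auto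
  then show "path_source (world_graph M) d \<in> states M" "path_target (world_graph M) d \<in> states M"
    by (auto simp: path_source_def path_target_def)
qed

sublocale TG: wf_digraph T
  by unfold_locales (use path_ends_in_states min_transitions_paths in \<open>simp; blast\<close>)+

lemma awalk_ends:
  assumes "TG.awalk u d v" "d \<noteq> []"
  shows "path_source T d = u" "path_target T d = v"
proof -
  have "TG.awlast u d = v" using assms(1) by (rule TG.awalkE)
  then show "path_target T d = v"
    using assms(2) by (simp add: path_target_def TG.awalk_verts_conv)
  show "path_source T d = u"
    using assms by (cases d) (simp_all add: path_source_def TG.awalk_Cons_iff)
qed

lemma action_paths_iff:
  "d \<in> action_paths M \<and> path_source T d = w \<longleftrightarrow>
   d \<noteq> [] \<and> TG.awalk w d (path_target T d)"
  unfolding action_paths_def paths_def using awalk_ends by blast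

lemma awalk_label_unique:
  "\<lbrakk>TG.awalk u d v; TG.awalk u d' v'; path_label M d = path_label M d'\<rbrakk> \<Longrightarrow> d = d'"
proof (induction d arbitrary: u d')
  case Nil
  then show ?case by (simp add: path_label_def)
next
  case (Cons e d)
  then obtain e' d'' where d': "d' = e' # d''"
    and l: "min_label M e = min_label M e'" "path_label M d = path_label M d''"
    by (auto simp: path_label_def Cons_eq_map_conv)
  have e: "e \<in> min_transitions M" "e' \<in> min_transitions M"
    "path_source (world_graph M) e = path_source (world_graph M) e'"
    using Cons.prems by (auto simp: d' TG.awalk_simps)
  then have "e = e'" using min_label_distinct l by blast
  then show ?case using Cons.IH Cons.prems l d' by (auto simp: TG.awalk_simps)
qed

lemma effect_eq_Some_iff:
  assumes "a \<noteq> []"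
  shows "effect M a w = Some v \<longleftrightarrow> (\<exists>d. TG.awalk w d v \<and> path_label M d = a)"
proof -
  define P where "P = (\<lambda>d. d \<in> action_paths M \<and> path_source T d = w \<and> path_label M d = a)"
  have P_iff: "P d \<longleftrightarrow> TG.awalk w d (path_target T d) \<and> path_label M d = a" for d
  proof -
    have "P d \<longleftrightarrow> (d \<noteq> [] \<and> TG.awalk w d (path_target T d)) \<and> path_label M d = a"
      unfolding P_def using action_paths_iff[of d w] by blast
    moreover have "d \<noteq> []" if "path_label M d = a" using that assms by (auto simp: path_label_def)
    ultimately show ?thesis by blast
  qed
  have the: "(THE d. P d) = d" if "P d" for d
  proof (rule the_equality[of P d, OF that])
    fix d' assume "P d'"
    then show "d' = d" using that awalk_label_unique unfolding P_iff by blast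
  qed
  have "effect M a w = Some v \<longleftrightarrow> (\<exists>d. P d \<and> path_target T d = v)"
    unfolding effect_def Let_def P_def[symmetric] using the by auto
  also have "\<dots> \<longleftrightarrow> (\<exists>d. TG.awalk w d v \<and> path_label M d = a)"
  proof -
    have "d \<noteq> []" if "path_label M d = a" for d using that assms by (auto simp: path_label_def)
    then show ?thesis unfolding P_iff using awalk_ends(2) by blast
  qed
  finally show ?thesis .
qed

lemma effect_in_states: "\<lbrakk>a \<noteq> []; effect M a w = Some v\<rbrakk> \<Longrightarrow> v \<in> states M"
proof -
  assume "a \<noteq> []" "effect M a w = Some v"
  then obtain d where "TG.awalk w d v" unfolding effect_eq_Some_iff[OF \<open>a \<noteq> []\<close>] by blast
  then have "v \<in> verts T" by (rule TG.awalk_last_in_verts)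
  then show "v \<in> states M" by simp
qed

lemma effect_comp:
  assumes "a \<noteq> []" "a' \<noteq> []"
  shows "effect M (action_comp a' a) w = Option.bind (effect M a w) (effect M a')"
proof -
  have "effect M (action_comp a' a) w = Some v \<longleftrightarrow>
        Option.bind (effect M a w) (effect M a') = Some v" for v
  proof -
    have "effect M (action_comp a' a) w = Some v \<longleftrightarrow>
        (\<exists>d d'. TG.awalk w (d @ d') v \<and> path_label M d = a \<and> path_label M d' = a')"
    proof -
      have "action_comp a' a \<noteq> []" using assms by (simp add: action_comp_def)
      then have "effect M (action_comp a' a) w = Some v \<longleftrightarrow>
          (\<exists>e. TG.awalk w e v \<and> map (min_label M) e = a @ a')"
        by (simp add: effect_eq_Some_iff path_label_def action_comp_def)
      then show ?thesis unfolding path_label_def map_eq_append_conv by blast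
    qed
    also have "\<dots> \<longleftrightarrow> (\<exists>x. effect M a w = Some x \<and> effect M a' x = Some v)"
      (is "?L \<longleftrightarrow> ?R")
    proof
      assume ?L
      then obtain d d' where d: "TG.awalk w (d @ d') v" "path_label M d = a" "path_label M d' = a'"
        by blast
      then have "TG.awalk w d (TG.awlast w d)" "TG.awalk (TG.awlast w d) d' v"
        by (simp_all only: TG.awalk_append_iff)
      then show ?R using d assms by (metis effect_eq_Some_iff)
    next
      assume ?R
      then obtain x d d' where d: "TG.awalk w d x" "path_label M d = a"
          "TG.awalk x d' v" "path_label M d' = a'"
        using assms by (metis effect_eq_Some_iff)
      then have "TG.awlast w d = x" by (metis TG.awalkE)
      then have "TG.awalk w (d @ d') v" using d by (simp only: TG.awalk_append_iff)
      then show ?L using d by blast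
    qed
    finally show ?thesis by (auto simp: bind_eq_Some_conv)
  qed
  moreover have "x = y" if "\<And>v. x = Some v \<longleftrightarrow> y = Some v" for x y :: "'w option"
    using that[of "the x"] that[of "the y"] by (cases x; cases y) simp_all
  ultimately show ?thesis by blast
qed

lemma action_comp_closed: "\<lbrakk>a \<in> actions M; a' \<in> actions M\<rbrakk> \<Longrightarrow> action_comp a' a \<in> actions M"
  by (auto simp: actions_def action_comp_def)

lemma class_comp_class:
  assumes "a \<in> actions M" "a' \<in> actions M"
  shows "class_comp M (act_equiv M `` {a'}) (act_equiv M `` {a}) =
         act_equiv M `` {action_comp a' a}"
proof -
  have "congruent2 (act_equiv M) (act_equiv M) (\<lambda>x y. act_equiv M `` {action_comp x y})"
  proof (rule congruent2I')
    fix x1 x2 y1 y2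
    assume xy: "(x1, x2) \<in> act_equiv M" "(y1, y2) \<in> act_equiv M"
    then have cl: "x1 \<in> actions M" "x2 \<in> actions M" "y1 \<in> actions M" "y2 \<in> actions M"
      by (auto simp: act_equiv_def)
    have "effect M (action_comp x1 y1) w = effect M (action_comp x2 y2) w" if "w \<in> states M" for w
    proof -
      have y: "effect M y1 w = effect M y2 w" using xy that by (auto simp: act_equiv_def)
      have "Option.bind (effect M y2 w) (effect M x1) = Option.bind (effect M y2 w) (effect M x2)"
        using xy cl effect_in_states[of y2 w]
        by (cases "effect M y2 w") (auto simp: act_equiv_def actions_def)
      then show ?thesis using cl y by (simp add: effect_comp actions_def)
    qed
    then have "(action_comp x1 y1, action_comp x2 y2) \<in> act_equiv M"
      using cl action_comp_closed by (auto simp: act_equiv_def)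
    then show "act_equiv M `` {action_comp x1 y1} = act_equiv M `` {action_comp x2 y2}"
      by (rule equiv_class_eq[OF equiv_act_equiv])
  qed
  then show ?thesis unfolding class_comp_def
    using UN_equiv_class2[OF equiv_act_equiv equiv_act_equiv] assms by blast
qed

lemma effect_id:
  assumes "w \<in> states M"
  shows "effect M [id_action M] w = Some w"
proof -
  interpret world "world_graph M" "trivial_arrow M" by (rule world)
  have "TG.awalk w [[trivial_arrow M w]] w \<and> path_label M [[trivial_arrow M w]] = [id_action M]"
    using assms triv_min_transition min_label_triv tail_triv head_triv
    by (auto simp: TG.awalk_simps path_label_def path_source_def path_target_def)
  then show ?thesis by (subst effect_eq_Some_iff) auto
qed

lemma monoid_act_monoid: "monoid (act_monoid M)"
proof -
  have id: "[id_action M] \<in> actions M"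
    using id_action_closed by (simp add: actions_def)
  have unit: "act_equiv M `` {action_comp a [id_action M]} = act_equiv M `` {a}"
             "act_equiv M `` {action_comp [id_action M] a} = act_equiv M `` {a}"
    if a: "a \<in> actions M" for a
  proof -
    have ne: "a \<noteq> []" using a by (simp add: actions_def)
    have "effect M (action_comp [id_action M] a) w = effect M a w" if "w \<in> states M" for w
      using ne effect_in_states[of a w] by (cases "effect M a w") (simp_all add: effect_comp effect_id)
    moreover have "effect M (action_comp a [id_action M]) w = effect M a w" if "w \<in> states M" for w
      using ne that by (simp add: effect_comp effect_id)
    ultimately have "(action_comp a [id_action M], a) \<in> act_equiv M"
                    "(action_comp [id_action M] a, a) \<in> act_equiv M"
      using a id action_comp_closed by (auto simp: act_equiv_def)
    then show "act_equiv M `` {action_comp a [id_action M]} = act_equiv M `` {a}"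
              "act_equiv M `` {action_comp [id_action M] a} = act_equiv M `` {a}"
      by (auto intro!: equiv_class_eq[OF equiv_act_equiv])
  qed
  have assoc: "action_comp (action_comp a b) c = action_comp a (action_comp b c)"
    for a b c :: "'a list" by (simp add: action_comp_def)
  show ?thesis
    by (rule monoidI)
      (auto simp: act_monoid_def class_comp_class action_comp_closed unit assoc id
        intro!: quotientI elim!: quotientE)
qed

end

end

theory Submission
  imports Defs
begin

text \<open>The witness is the inverse of \<open>a\<close> in the group \<open>act_monoid M\<close>:
  both composites are then the identity class, which fixes every state by the unit law of a group
  action.\<close>

theorem proposition9:
  fixes M :: "('w, 'd, 'a) agent_world"
  assumes "agent_world M"
    and "effect_is_group_action M"
  shows "\<forall>a \<in> actions M // act_equiv M. \<exists>a' \<in> actions M // act_equiv M. \<forall>w \<in> states M.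
           class_effect M (class_comp M a' a) w = Some w \<and>
           class_effect M (class_comp M a a') w = Some w"
proof
  interpret group "act_monoid M"
    using assms(2) by (simp add: effect_is_group_action_def)
  have one: "class_effect M \<one>\<^bsub>act_monoid M\<^esub> w = Some w" if "w \<in> states M" for w
    using assms(2) that by (simp add: effect_is_group_action_def)
  fix a assume "a \<in> actions M // act_equiv M"
  then have a: "a \<in> carrier (act_monoid M)" by (simp add: act_monoid_def)
  \<comment> \<open>Turns \<open>class_comp\<close> into the group product, so that the inverse laws
    of \<open>group\<close> can rewrite it.\<close>
  have mult: "class_comp M x y = x \<otimes>\<^bsub>act_monoid M\<^esub> y" for x y
    by (simp add: act_monoid_def)
  show "\<exists>a' \<in> actions M // act_equiv M. \<forall>w \<in> states M.
           class_effect M (class_comp M a' a) w = Some w \<and>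
           class_effect M (class_comp M a a') w = Some w"
  proof (intro bexI ballI)
    \<comment> \<open>Proving membership first instantiates the schematic witness left by
      \<open>bexI\<close>.\<close>
    show "inv\<^bsub>act_monoid M\<^esub> a \<in> actions M // act_equiv M"
      using inv_closed[OF a] by (simp add: act_monoid_def)
  \<comment> \<open>The simp rules \<open>l_inv\<close> and \<open>r_inv\<close> reduce both
    products to the unit, where \<open>one\<close> applies.\<close>
  qed (simp add: mult a one)
qed

end
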